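(* Let $q\in\mathbb{C}$ with $0<|q|<1$. Consider the divergent alternating series $\widetilde{\phi}(q)=\sum_{n=0}^{\infty}\frac{(-1)^n}{(-q;q)_n}$ with partial sums $s_N=\sum_{n=0}^{N}\frac{(-1)^n}{(-q;q)_n}$. Then the limits $\widetilde{\phi}_{+}(q):=\lim_{N\to\infty}s_{2N+1}$ and $\widetilde{\phi}_{-}(q):=\lim_{N\to\infty}s_{2N}$ exist, and $$f(q)=2\widetilde{\phi}_{+}(q)+\frac{1}{(-q;q)_\infty},\qquad f(q)=2\widetilde{\phi}_{-}(q)-\frac{1}{(-q;q)_\infty},$$ where $f(q):=\sum_{n=0}^{\infty}\frac{q^{n^2}}{(-q;q)_n^{2}}$ is Ramanujan's mock theta function.
   Context: The $q$-Pochhammer symbol is $(a;q)_0:=1$, $(a;q)_n:=\prod_{j=0}^{n-1}(1-aq^j)$ for $n\ge 1$, and $(a;q)_\infty:=\lim_{n\to\infty}(a;q)_n$ for $|q|<1$. For an infinite series, $S_+$ denotes the limit of the partial sums whose last summand has odd index and $S_-$ the limit of those whose last summand has even index. *)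

theory Defs
  imports "HOL-Analysis.Analysis"
begin

definition qpoch :: "complex \<Rightarrow> complex \<Rightarrow> nat \<Rightarrow> complex" where
  "qpoch a q n = (\<Prod>j<n. 1 - a * q ^ j)"

definition qpoch_inf :: "complex \<Rightarrow> complex \<Rightarrow> complex" where
  "qpoch_inf a q = lim (\<lambda>n. qpoch a q n)"

text \<open>
  For a series with terms \<open>a 0, a 1, \<dots>\<close>, the limits of the partial sums whose last summand
  has odd (respectively even) index. As \<open>lim\<close> is total, these values are meaningful only
  if the corresponding sequence of partial sums is convergent.
\<close>

definition odd_partial_sums :: "(nat \<Rightarrow> complex) \<Rightarrow> nat \<Rightarrow> complex" where
  "odd_partial_sums a N = (\<Sum>n\<le>2 * N + 1. a n)"

definition even_partial_sums :: "(nat \<Rightarrow> complex) \<Rightarrow> nat \<Rightarrow> complex" where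
  "even_partial_sums a N = (\<Sum>n\<le>2 * N. a n)"

definition S_plus :: "(nat \<Rightarrow> complex) \<Rightarrow> complex" where
  "S_plus a = lim (odd_partial_sums a)"

definition S_minus :: "(nat \<Rightarrow> complex) \<Rightarrow> complex" where
  "S_minus a = lim (even_partial_sums a)"

definition phi_term :: "complex \<Rightarrow> nat \<Rightarrow> complex" where
  "phi_term q n = (-1) ^ n / qpoch (-q) q n"

definition mock_theta_f :: "complex \<Rightarrow> complex" where
  "mock_theta_f q = (\<Sum>n. q ^ (n ^ 2) / (qpoch (-q) q n) ^ 2)"

text \<open>
  The following facts show that, for \<open>norm q < 1\<close>, neither \<open>lim\<close>, \<open>suminf\<close> nor division
  takes a default value in the definitions above.
\<close>

lemma convergent_prod_qpoch:
  fixes a q :: complex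
  assumes "norm q < 1"
  shows "convergent_prod (\<lambda>j. 1 - a * q ^ j)"
proof -
  have "summable (\<lambda>j. norm (a * q ^ j))"
    unfolding norm_mult norm_power using assms by (intro summable_mult summable_geometric) simp
  hence "summable (\<lambda>j. norm ((1 - a * q ^ j) - 1))"
    by simp
  hence "abs_convergent_prod (\<lambda>j. 1 - a * q ^ j)"
    by (rule summable_imp_abs_convergent_prod)
  thus ?thesis
    by (rule abs_convergent_prod_imp_convergent_prod)
qed

lemma qpoch_LIMSEQ:
  assumes "norm q < 1"
  shows "(\<lambda>n. qpoch a q n) \<longlonglongrightarrow> qpoch_inf a q"
proof -
  have "convergent (\<lambda>n. \<Prod>j\<le>n. 1 - a * q ^ j)"
    using convergent_prod_qpoch[OF assms] by (rule convergent_prod_imp_convergent)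
  hence "convergent (\<lambda>n. qpoch a q (Suc n))"
    by (simp add: qpoch_def lessThan_Suc_atMost)
  hence "convergent (\<lambda>n. qpoch a q n)"
    by (rule convergent_Suc_iff[THEN iffD1])
  thus ?thesis
    by (simp add: qpoch_inf_def convergent_LIMSEQ_iff)
qed

lemma qpoch_factor_nonzero:
  assumes "norm (q::complex) < 1"
  shows "1 - (-q) * q ^ j \<noteq> 0"
proof
  assume "1 - (-q) * q ^ j = 0"
  hence "q ^ Suc j = -1"
    by (simp add: add_eq_0_iff)
  hence "norm q ^ Suc j = 1"
    by (metis norm_minus_cancel norm_one norm_power)
  moreover have "norm q ^ Suc j < 1"
    using assms by (simp add: power_less_one_iff del: power_Suc)
  ultimately show False
    by simp
qed

lemma qpoch_nonzero:
  assumes "norm q < 1"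
  shows "qpoch (-q) q n \<noteq> 0"
  unfolding qpoch_def using qpoch_factor_nonzero[OF assms] by (simp del: mult_minus_left)

lemma qpoch_inf_nonzero:
  assumes "norm q < 1"
  shows "qpoch_inf (-q) q \<noteq> 0"
proof -
  have "(\<lambda>n. \<Prod>j\<le>n. 1 - (-q) * q ^ j) \<longlonglongrightarrow> prodinf (\<lambda>j. 1 - (-q) * q ^ j)"
    using convergent_prod_qpoch[OF assms] by (rule convergent_prod_LIMSEQ)
  moreover have "(\<lambda>n. \<Prod>j\<le>n. 1 - (-q) * q ^ j) \<longlonglongrightarrow> qpoch_inf (-q) q"
    using LIMSEQ_Suc[OF qpoch_LIMSEQ[OF assms, of "-q"]]
    unfolding qpoch_def lessThan_Suc_atMost .
  ultimately have "qpoch_inf (-q) q = prodinf (\<lambda>j. 1 - (-q) * q ^ j)"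
    using LIMSEQ_unique by blast
  thus ?thesis
    using prodinf_nonzero[OF convergent_prod_qpoch[OF assms] qpoch_factor_nonzero[OF assms]]
    by simp
qed

lemma summable_mock_theta_f:
  assumes "norm q < 1"
  shows "summable (\<lambda>n. q ^ (n ^ 2) / (qpoch (-q) q n) ^ 2)"
proof -
  have "(\<lambda>n. 1 / (qpoch (-q) q n) ^ 2) \<longlonglongrightarrow> 1 / (qpoch_inf (-q) q) ^ 2"
    using qpoch_inf_nonzero[OF assms] by (intro tendsto_intros qpoch_LIMSEQ assms) auto
  hence "Bseq (\<lambda>n. 1 / (qpoch (-q) q n) ^ 2)"
    by (intro convergent_imp_Bseq convergentI)
  then obtain K where K: "K > 0" "\<And>n. norm (1 / (qpoch (-q) q n) ^ 2) \<le> K"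
    by (auto simp: Bseq_def)
  show ?thesis
  proof (rule summable_comparison_test')
    show "summable (\<lambda>n. norm q ^ n * K)"
      using assms by (intro summable_mult2 summable_geometric) auto
    fix n :: nat
    have "norm q ^ (n ^ 2) \<le> norm q ^ n"
      using assms by (intro power_decreasing) (auto simp: power2_eq_square)
    hence "norm (q ^ (n ^ 2)) * norm (1 / (qpoch (-q) q n) ^ 2) \<le> norm q ^ n * K"
      using K by (intro mult_mono) (auto simp: norm_power)
    thus "norm (q ^ (n ^ 2) / (qpoch (-q) q n) ^ 2) \<le> norm q ^ n * K"
      by (simp add: norm_mult norm_divide)
  qed
qed

end

theory Submission
  imports Defs
begin

text \<open>
  Write \<open>P n = (-q;q)\<^sub>n\<close> and \<open>U K = (\<Sum>n. (-1)^n q^(K n) / P (K + n))\<close>, so that the divergent series is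
  \<open>U 0\<close>. Multiplying by \<open>1 + q^K\<close> and summing by parts gives the \<open>a \<rightarrow> 0\<close> case of the
  recurrence behind the Rogers-Fine identity,
  \<open>(1 + q^K) U K = 1 / P K + q^(2 K + 1) U (K + 1)\<close>.
  For the partial sums of \<open>U 0\<close>, there is the additional boundary term \<open>(-1)^N / P N\<close>, which
  is responsible for the two limits. Iterating the recurrence from \<open>K = 1\<close> on produces the
  series of \<open>f\<close>.
\<close>

definition fine_psum :: "complex \<Rightarrow> nat \<Rightarrow> nat \<Rightarrow> complex" where
  "fine_psum q K N = (\<Sum>n<N. (-1) ^ n * q ^ (K * n) / qpoch (-q) q (K + n))"

text \<open>A genuine sum only for \<open>K > 0\<close>. For \<open>norm q < 1\<close> and
  \<open>K = 0\<close> the terms do not tend to zero, so that case is handled through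
  \<open>fine_psum\<close> alone.\<close>

definition fine_sum :: "complex \<Rightarrow> nat \<Rightarrow> complex" where
  "fine_sum q K = (\<Sum>n. (-1) ^ n * q ^ (K * n) / qpoch (-q) q (K + n))"

lemma inverse_qpoch_Suc:
  assumes "norm q < 1"
  shows "1 / qpoch (-q) q n = (1 + q ^ Suc n) / qpoch (-q) q (Suc n)"
proof -
  have "1 + q ^ Suc n \<noteq> 0"
    using qpoch_factor_nonzero[OF assms, of n] by simp
  moreover have "qpoch (-q) q (Suc n) = qpoch (-q) q n * (1 + q ^ Suc n)"
    by (simp add: qpoch_def)
  ultimately show ?thesis
    by simp
qed

text \<open>Being finite, the identity also covers the divergent case \<open>K = 0\<close>. The
  boundary term tends to zero for \<open>K > 0\<close> and alternates in sign for
  \<open>K = 0\<close>.\<close>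

lemma fine_psum_rec:
  assumes "norm q < 1"
  shows "(1 + q ^ K) * fine_psum q K (Suc N) =
    1 / qpoch (-q) q K + q ^ (2 * K + 1) * fine_psum q (Suc K) N
      + (-1) ^ N * q ^ (K * Suc N) / qpoch (-q) q (K + N)"
proof (induction N)
  case 0
  then show ?case
    by (simp add: fine_psum_def add_divide_distrib)
next
  case (Suc N)
  define c where "c = 1 / qpoch (-q) q (K + Suc N)"
  have c: "1 / qpoch (-q) q (K + N) = (1 + q ^ Suc (K + N)) * c"
    using inverse_qpoch_Suc[OF assms, of "K + N"] by (simp add: c_def)
  have step: "fine_psum q K (Suc (Suc N)) =
      fine_psum q K (Suc N) + (-1) ^ Suc N * q ^ (K * Suc N) * c"
    "fine_psum q (Suc K) (Suc N) = fine_psum q (Suc K) N + (-1) ^ N * q ^ (Suc K * N) * c"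
    by (simp_all add: fine_psum_def c_def)
  have IH: "(1 + q ^ K) * fine_psum q K (Suc N) =
    1 / qpoch (-q) q K + q ^ (2 * K + 1) * fine_psum q (Suc K) N
      + (-1) ^ N * q ^ (K * Suc N) * ((1 + q ^ Suc (K + N)) * c)"
    unfolding c[symmetric] using Suc.IH by simp
  \<comment> \<open>Up to the common factor \<open>(-1) ^ N * q ^ (K * Suc N) * c\<close>, this says
    \<open>-(1 + q^K) = q^(K+N+1) - q^K - (1 + q^(K+N+1))\<close>.\<close>
  have "(1 + q ^ K) * ((-1) ^ Suc N * q ^ (K * Suc N) * c) =
      q ^ (2 * K + 1) * ((-1) ^ N * q ^ (Suc K * N) * c)
      + (-1) ^ Suc N * q ^ (K * Suc (Suc N)) * c
      - (-1) ^ N * q ^ (K * Suc N) * ((1 + q ^ Suc (K + N)) * c)"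
    by (simp add: algebra_simps power_add mult_2 mult_2_right)
  moreover have "(-1) ^ Suc N * q ^ (K * Suc (Suc N)) / qpoch (-q) q (K + Suc N) =
      (-1) ^ Suc N * q ^ (K * Suc (Suc N)) * c"
    by (simp add: c_def)
  ultimately show ?case
    using IH unfolding step distrib_left [of "1 + q ^ K"] distrib_left [of "q ^ (2 * K + 1)"]
    by (simp del: power_Suc mult_Suc_right mult_Suc)
qed

lemma inverse_qpoch_LIMSEQ:
  assumes "norm q < 1"
  shows "(\<lambda>n. 1 / qpoch (-q) q n) \<longlonglongrightarrow> 1 / qpoch_inf (-q) q"
  using qpoch_inf_nonzero[OF assms] by (intro tendsto_intros qpoch_LIMSEQ assms)

lemma inverse_qpoch_bounded:
  assumes "norm q < 1"
  obtains M where "M > 0" "\<And>n. norm (1 / qpoch (-q) q n) \<le> M"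
proof -
  have "Bseq (\<lambda>n. 1 / qpoch (-q) q n)"
    using inverse_qpoch_LIMSEQ[OF assms] by (intro convergent_imp_Bseq convergentI)
  thus ?thesis
    using that by (auto simp: Bseq_def)
qed

text \<open>The geometric majorant does not depend on \<open>K\<close>, which is what makes the
  later bound on \<open>fine_sum\<close> uniform.\<close>

lemma fine_term_bound:
  assumes "norm q < 1" "K > 0" "\<And>n. norm (1 / qpoch (-q) q n) \<le> M"
  shows "norm ((-1) ^ n * q ^ (K * n) / qpoch (-q) q (K + n)) \<le> norm q ^ n * M"
proof -
  have "norm q ^ (K * n) \<le> norm q ^ n"
    using assms by (intro power_decreasing) auto
  hence "norm q ^ (K * n) * norm (1 / qpoch (-q) q (K + n)) \<le> norm q ^ n * M"
    using assms(3) by (intro mult_mono) auto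
  thus ?thesis
    by (simp add: norm_mult norm_divide norm_power)
qed

lemma fine_psum_LIMSEQ:
  assumes "norm q < 1" "K > 0"
  shows "fine_psum q K \<longlonglongrightarrow> fine_sum q K"
proof -
  obtain M where M: "\<And>n. norm (1 / qpoch (-q) q n) \<le> M"
    using inverse_qpoch_bounded[OF assms(1)] by blast
  have "summable (\<lambda>n. (-1) ^ n * q ^ (K * n) / qpoch (-q) q (K + n))"
  proof (rule summable_comparison_test')
    show "summable (\<lambda>n. norm q ^ n * M)"
      using assms(1) by (intro summable_mult2 summable_geometric) auto
  qed (use fine_term_bound[OF assms M] in blast)
  thus ?thesis
    unfolding fine_psum_def fine_sum_def by (rule summable_LIMSEQ)
qed

text \<open>Uniformity in \<open>K\<close> matters because iterating the recurrence raises
  \<open>K\<close> at every step.\<close>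

lemma fine_sum_bounded:
  assumes "norm q < 1"
  obtains B where "\<And>K. K > 0 \<Longrightarrow> norm (fine_sum q K) \<le> B"
proof -
  obtain M where M: "\<And>n. norm (1 / qpoch (-q) q n) \<le> M"
    using inverse_qpoch_bounded[OF assms] by blast
  have "norm (fine_sum q K) \<le> (\<Sum>n. norm q ^ n * M)" if "K > 0" for K
    unfolding fine_sum_def
  proof (rule norm_suminf_le)
    show "summable (\<lambda>n. norm q ^ n * M)"
      using assms by (intro summable_mult2 summable_geometric) auto
  qed (use fine_term_bound[OF assms that M] in blast)
  thus ?thesis
    using that by blast
qed

lemma fine_sum_rec:
  assumes "norm q < 1" "K > 0"
  shows "(1 + q ^ K) * fine_sum q K =
    1 / qpoch (-q) q K + q ^ (2 * K + 1) * fine_sum q (Suc K)"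
proof -
  obtain M where M: "\<And>n. norm (1 / qpoch (-q) q n) \<le> M"
    using inverse_qpoch_bounded[OF assms(1)] by blast
  \<comment> \<open>The boundary term carries the exponent \<open>K * Suc N\<close>, hence one
    factor \<open>q ^ K\<close> more than the series term bounded by
    \<open>fine_term_bound\<close>.\<close>
  have "(\<lambda>N. q ^ K * ((-1) ^ N * q ^ (K * N) / qpoch (-q) q (K + N))) \<longlonglongrightarrow> q ^ K * 0"
  proof (rule tendsto_mult_left, rule Lim_null_comparison)
    show "\<forall>\<^sub>F N in sequentially.
        norm ((-1) ^ N * q ^ (K * N) / qpoch (-q) q (K + N)) \<le> norm q ^ N * M"
      using fine_term_bound[OF assms M] by simp
    show "(\<lambda>N. norm q ^ N * M) \<longlonglongrightarrow> 0"
      using assms(1) by (intro tendsto_mult_left_zero LIMSEQ_power_zero) auto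
  qed
  hence "(\<lambda>N. (-1) ^ N * q ^ (K * Suc N) / qpoch (-q) q (K + N)) \<longlonglongrightarrow> 0"
    by (simp add: power_add mult_ac)
  hence "(\<lambda>N. (1 + q ^ K) * fine_psum q K (Suc N)) \<longlonglongrightarrow>
      1 / qpoch (-q) q K + q ^ (2 * K + 1) * fine_sum q (Suc K) + 0"
    unfolding fine_psum_rec[OF assms(1)] using assms(1)
    by (intro tendsto_add tendsto_mult tendsto_const fine_psum_LIMSEQ) auto
  moreover have "(\<lambda>N. (1 + q ^ K) * fine_psum q K (Suc N)) \<longlonglongrightarrow> (1 + q ^ K) * fine_sum q K"
    by (intro tendsto_mult tendsto_const LIMSEQ_Suc fine_psum_LIMSEQ assms)
  ultimately show ?thesis
    using LIMSEQ_unique by fastforce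
qed

lemma mock_theta_f_eq_fine_sum:
  assumes "norm q < 1"
  shows "mock_theta_f q = 1 + q * fine_sum q 1"
proof -
  define t where "t = (\<lambda>n. q ^ (n ^ 2) / (qpoch (-q) q n) ^ 2)"
  \<comment> \<open>\<open>V n\<close> is the remainder after \<open>n\<close> iterations from
    \<open>K = 1\<close>: \<open>1 + V 0\<close> equals \<open>t 0 + ... + t n + V n\<close>. The
    factors \<open>q ^ (2 * K + 1)\<close> accumulate to a square exponent, since consecutive
    squares differ by odd numbers.\<close>
  define V where "V = (\<lambda>n. q ^ (Suc n ^ 2) * fine_sum q (Suc n) / qpoch (-q) q n)"
  obtain M where M: "M > 0" "\<And>n. norm (1 / qpoch (-q) q n) \<le> M"
    using inverse_qpoch_bounded[OF assms] by blast
  obtain B where B: "\<And>K. K > 0 \<Longrightarrow> norm (fine_sum q K) \<le> B"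
    using fine_sum_bounded[OF assms] by blast
  have V_rec: "V n - V (Suc n) = t (Suc n)" for n
  proof -
    define p where "p = qpoch (-q) q (Suc n)"
    have "V n = q ^ (Suc n ^ 2) * fine_sum q (Suc n) * (1 / qpoch (-q) q n)"
      by (simp add: V_def)
    also have "\<dots> = q ^ (Suc n ^ 2) / p * ((1 + q ^ Suc n) * fine_sum q (Suc n))"
      unfolding inverse_qpoch_Suc[OF assms, of n] p_def by simp
    also have "\<dots> = q ^ (Suc n ^ 2) / p *
        (1 / p + q ^ (2 * Suc n + 1) * fine_sum q (Suc (Suc n)))"
      unfolding p_def by (subst fine_sum_rec[OF assms]) simp_all
    also have "\<dots> = t (Suc n) +
        q ^ (Suc n ^ 2) * q ^ (2 * Suc n + 1) * fine_sum q (Suc (Suc n)) / p"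
      by (simp add: t_def p_def distrib_left power2_eq_square)
    also have "q ^ (Suc n ^ 2) * q ^ (2 * Suc n + 1) = q ^ (Suc (Suc n) ^ 2)"
      by (subst power_add[symmetric], rule arg_cong[where f = "(^) q"])
        (simp add: power2_eq_square algebra_simps)
    finally show ?thesis
      by (simp add: V_def p_def)
  qed
  have "V \<longlonglongrightarrow> 0"
  proof (rule Lim_null_comparison)
    have "norm (V n) \<le> norm q ^ n * (B * M)" for n
    proof -
      have "norm q ^ (Suc n ^ 2) \<le> norm q ^ n"
        using assms by (intro power_decreasing) (auto simp: power2_eq_square)
      hence "norm q ^ (Suc n ^ 2) * (norm (fine_sum q (Suc n)) * norm (1 / qpoch (-q) q n))
          \<le> norm q ^ n * (B * M)"
        \<comment> \<open>The \<open>order_trans\<close> fact supplies \<open>0 \<le> B\<close>,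
          which \<open>mult_mono\<close> requires.\<close>
        using B[of "Suc n"] M order_trans[OF norm_ge_zero B[of "Suc n"]] by (intro mult_mono) auto
      thus ?thesis
        by (simp add: V_def norm_mult norm_divide norm_power)
    qed
    thus "\<forall>\<^sub>F n in sequentially. norm (V n) \<le> norm q ^ n * (B * M)"
      by simp
    show "(\<lambda>n. norm q ^ n * (B * M)) \<longlonglongrightarrow> 0"
      using assms by (intro tendsto_mult_left_zero LIMSEQ_power_zero) auto
  qed
  hence "(\<lambda>n. V n - V (Suc n)) sums (V 0 - 0)"
    by (rule telescope_sums')
  hence "(\<lambda>n. t (Suc n)) sums (q * fine_sum q 1)"
    unfolding V_rec by (simp add: V_def qpoch_def)
  hence "t sums (q * fine_sum q 1 + t 0)"
    by (rule sums_Suc)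
  thus ?thesis
    by (simp add: mock_theta_f_def t_def sums_iff qpoch_def)
qed

text \<open>This is the recurrence at \<open>K = 0\<close>: the factor \<open>1 + q ^ 0\<close>
  becomes the 2 of the theorem, and the boundary term keeps its size because
  \<open>q ^ 0 = 1\<close>.\<close>

lemma phi_partial_sum_eq:
  assumes "norm q < 1"
  shows "2 * (\<Sum>n\<le>N. phi_term q n) =
    1 + q * fine_psum q 1 N + (-1) ^ N / qpoch (-q) q N"
proof -
  have "(\<Sum>n\<le>N. phi_term q n) = fine_psum q 0 (Suc N)"
    by (simp add: fine_psum_def phi_term_def lessThan_Suc_atMost)
  thus ?thesis
    using fine_psum_rec[OF assms, of 0 N] by (simp add: qpoch_def)
qed

text \<open>Along indices of constant parity the sign of the boundary term is a constant
  \<open>s\<close>, so one argument gives both limits: \<open>s = -1\<close> for odd and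
  \<open>s = 1\<close> for even indices.\<close>

lemma phi_partial_sums_LIMSEQ:
  assumes q: "norm q < 1" and r: "strict_mono r" and sgn: "\<And>N. (-1) ^ r N = (s :: complex)"
  shows "(\<lambda>N. \<Sum>n\<le>r N. phi_term q n) \<longlonglongrightarrow> (mock_theta_f q + s / qpoch_inf (-q) q) / 2"
proof -
  have "(\<lambda>N. (1 + q * fine_psum q 1 (r N) + s * (1 / qpoch (-q) q (r N))) / 2) \<longlonglongrightarrow>
      (1 + q * fine_sum q 1 + s * (1 / qpoch_inf (-q) q)) / 2"
    using LIMSEQ_subseq_LIMSEQ[OF fine_psum_LIMSEQ[OF q] r, of 1]
      LIMSEQ_subseq_LIMSEQ[OF inverse_qpoch_LIMSEQ[OF q] r]
    unfolding o_def
    by (intro tendsto_divide[of _ _ _ "\<lambda>_. 2"] tendsto_add tendsto_mult tendsto_const) simp_all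
  moreover have "(\<Sum>n\<le>r N. phi_term q n) =
      (1 + q * fine_psum q 1 (r N) + s * (1 / qpoch (-q) q (r N))) / 2" for N
    using phi_partial_sum_eq[OF q, of "r N"] by (simp add: sgn field_simps)
  ultimately show ?thesis
    unfolding mock_theta_f_eq_fine_sum[OF q] by (simp only: times_divide_eq_right mult_1_right)
qed

theorem theorem2:
  fixes q :: complex
  assumes "0 < norm q" and "norm q < 1"
  shows "convergent (odd_partial_sums (phi_term q))
       \<and> convergent (even_partial_sums (phi_term q))
       \<and> mock_theta_f q = 2 * S_plus (phi_term q) + 1 / qpoch_inf (-q) q
       \<and> mock_theta_f q = 2 * S_minus (phi_term q) - 1 / qpoch_inf (-q) q"
proof -
  have odd: "odd_partial_sums (phi_term q) \<longlonglongrightarrow> (mock_theta_f q + (-1) / qpoch_inf (-q) q) / 2"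
    unfolding odd_partial_sums_def
    by (rule phi_partial_sums_LIMSEQ[OF assms(2)]) (auto simp: strict_mono_def)
  have even: "even_partial_sums (phi_term q) \<longlonglongrightarrow> (mock_theta_f q + 1 / qpoch_inf (-q) q) / 2"
    unfolding even_partial_sums_def
    by (rule phi_partial_sums_LIMSEQ[OF assms(2)]) (auto simp: strict_mono_def)
  have "S_plus (phi_term q) = (mock_theta_f q + (-1) / qpoch_inf (-q) q) / 2"
    "S_minus (phi_term q) = (mock_theta_f q + 1 / qpoch_inf (-q) q) / 2"
    unfolding S_plus_def S_minus_def by (intro limI odd even)+
  thus ?thesis
    using convergentI[OF odd] convergentI[OF even] by (simp add: field_simps)
qed

end
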